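(* Let $M$ be a $\mathcal C^\infty$-smooth real hypersurface germ in $\mathbb C^2$ at the origin defined by $$\rho(z_1,z_2)=\operatorname{Re} z_1 + P(z_2) + (\operatorname{Im} z_1)\,Q(z_2,\operatorname{Im} z_1)=0,$$ where $P$ and $Q$ are real-valued $\mathcal C^\infty$-smooth functions (defined near $0\in\mathbb C$ and near $(0,0)\in\mathbb C\times\mathbb R$, respectively) with $P(0)=0$, $dP(0)=0$ and $Q(0,0)=0$. Assume also that $\frac{\partial^N P}{\partial z_2^N}\Big|_{z_2=0}=0$ for every nonnegative integer $N$. Then the origin is a point of infinite type of $M$ if and only if $P(z_2)$ vanishes to infinite order at $z_2=0$.
   Context: $\partial/\partial z_2$ denotes the Wirtinger derivative. For a smooth real-valued function $f$ defined near $0\in\mathbb C$, $\nu_0(f)$ denotes the order of vanishing of $f$ at $0$: the degree of the first nonvanishing homogeneous term in its Taylor expansion at $0$, with $\nu_0(f)=\infty$ if all terms vanish. $f$ vanishes to infinite order at $0$ if $\nu_0(f)=\infty$. For a smooth map $f$ into $\mathbb R^k$, $\nu_0(f)$ is the minimum of the orders of vanishing of its components (a map into $\mathbb C^2$ is viewed as a map into $\mathbb R^4$). Let $\Delta=\{z\in\mathbb C:|z|<1\}$. The origin is called a point of infinite type of $M=\{\rho=0\}$ if, for every integer $\ell>0$, there exists a holomorphic map $h:\Delta\to\mathbb C^2$ with $h(0)=(0,0)$ such that $\nu_0(h)\neq\infty$ and $\frac{\nu_0(\rho\circ h)}{\nu_0(h)}>\ell$ (here $\rho\circ h$ need only be defined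 near $0\in\Delta$). *)

theory Defs
  imports "HOL-Analysis.Analysis"
begin

definition dir_deriv ::
  "'a::real_normed_vector \<Rightarrow> ('a \<Rightarrow> 'b::real_normed_vector) \<Rightarrow> 'a \<Rightarrow> 'b" where
  "dir_deriv v f x = frechet_derivative f (at x) v"

(* Intended for open S only. *)
primrec Ck_on ::
  "nat \<Rightarrow> 'a::euclidean_space set \<Rightarrow> ('a \<Rightarrow> 'b::real_normed_vector) \<Rightarrow> bool" where
  "Ck_on 0 S f \<longleftrightarrow> continuous_on S f"
| "Ck_on (Suc k) S f \<longleftrightarrow>
     (\<forall>x\<in>S. f differentiable (at x)) \<and> (\<forall>e\<in>Basis. Ck_on k S (dir_deriv e f))"

definition smooth_near ::
  "'a::euclidean_space \<Rightarrow> ('a \<Rightarrow> 'b::real_normed_vector) \<Rightarrow> bool" where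
  "smooth_near x f \<longleftrightarrow> (\<exists>S. open S \<and> x \<in> S \<and> (\<forall>k. Ck_on k S f))"

(* The degree n homogeneous term of the Taylor expansion of f at 0, evaluated at v:
   (1/n!) (v . grad)^n f (0), i.e. in real coordinates the sum over |\<alpha>| = n of
   D^\<alpha> f(0) v^\<alpha> / \<alpha>!. *)
definition taylor_term :: "('a::real_normed_vector \<Rightarrow> real) \<Rightarrow> nat \<Rightarrow> 'a \<Rightarrow> real" where
  "taylor_term f n v = ((dir_deriv v ^^ n) f) 0 / fact n"

definition vanish_order :: "('a::real_normed_vector \<Rightarrow> real) \<Rightarrow> enat" where
  "vanish_order f =
     (if \<forall>n v. taylor_term f n v = 0 then \<infinity>
      else enat (LEAST n. \<exists>v. taylor_term f n v \<noteq> 0))"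

(* For maps into complex \<times> complex, Basis gives the four real components
   Re h1, Im h1, Re h2, Im h2. *)
definition vanish_order_map ::
  "('a::real_normed_vector \<Rightarrow> 'b::euclidean_space) \<Rightarrow> enat" where
  "vanish_order_map f = Min ((\<lambda>e. vanish_order (\<lambda>x. f x \<bullet> e)) ` Basis)"

definition wirtinger :: "(complex \<Rightarrow> complex) \<Rightarrow> complex \<Rightarrow> complex" where
  "wirtinger f z = (dir_deriv 1 f z - \<i> * dir_deriv \<i> f z) / 2"

(* The quotient is formed in the extended reals, so it is \<infinity> when the numerator is \<infinity>;
   the denominator is finite, and nonzero because h 0 = 0. *)
definition infinite_type_at_0 :: "(complex \<times> complex \<Rightarrow> real) \<Rightarrow> bool" where
  "infinite_type_at_0 \<rho> \<longleftrightarrow>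
     (\<forall>l::int. l > 0 \<longrightarrow>
       (\<exists>h :: complex \<Rightarrow> complex \<times> complex.
          (\<lambda>z. fst (h z)) holomorphic_on ball 0 1 \<and>
          (\<lambda>z. snd (h z)) holomorphic_on ball 0 1 \<and>
          h 0 = (0, 0) \<and>
          vanish_order_map h \<noteq> \<infinity> \<and>
          ereal_of_enat (vanish_order (\<rho> \<circ> h)) / ereal_of_enat (vanish_order_map h)
            > ereal (real_of_int l)))"

end

theory Submission
  imports Defs "HOL-Complex_Analysis.Complex_Analysis"
begin

text \<open>If \<open>P\<close> vanishes to infinite order, the curve \<open>h z = (0, z)\<close> has \<open>\<rho> \<circ> h = P\<close>.
  Conversely let \<open>m\<close> be the finite order of \<open>P\<close> and \<open>T\<close> its leading Taylor term, and write
  \<open>h = z^k (u1, u2)\<close> with \<open>(u1 0, u2 0) \<noteq> 0\<close>. Then \<open>\<rho> \<circ> h\<close> has order at most \<open>m k\<close>: the term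
  \<open>Im h1 * Q\<close> is of higher order than \<open>h1\<close>, so vanishing beyond \<open>m k\<close> would force the leading terms
  of \<open>Re h1\<close> and \<open>P \<circ> h2\<close> to cancel, making \<open>T w = Re (a w^m)\<close> for some \<open>a\<close>. The Wirtinger
  condition excludes harmonic terms, so \<open>a = 0\<close> and \<open>T = 0\<close>, a contradiction.\<close>

section \<open>Functions of class $C^k$\<close>

lemma dir_deriv_eqI: "(f has_derivative f') (at x) \<Longrightarrow> dir_deriv v f x = f' v"
  unfolding dir_deriv_def using frechet_derivative_at by metis

lemma dir_deriv_cong_open:
  assumes "open S" "x \<in> S" "\<And>y. y \<in> S \<Longrightarrow> f y = g y" "f differentiable (at x)"
  shows "g differentiable (at x)" "dir_deriv v g x = dir_deriv v f x"
proof -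
  obtain f' where f': "(f has_derivative f') (at x)"
    using assms(4) by (auto simp: differentiable_def)
  then have g': "(g has_derivative f') (at x)"
    using has_derivative_transform_within_open[OF _ assms(1,2)] assms(3) by blast
  then show "g differentiable (at x)" "dir_deriv v g x = dir_deriv v f x"
    using f' by (auto simp: differentiable_def dir_deriv_eqI)
qed

lemma Ck_on_cong_open:
  assumes "open S" "\<And>x. x \<in> S \<Longrightarrow> f x = g x" "Ck_on k S f"
  shows "Ck_on k S g"
  using assms(2,3)
proof (induction k arbitrary: f g)
  case 0
  then show ?case by (auto cong: continuous_on_cong)
next
  case (Suc k)
  have d: "f differentiable (at x)" if "x \<in> S" for x using Suc.prems that by auto
  show ?case
    using Suc.prems dir_deriv_cong_open[OF assms(1) _ _ d, of _ g]
    by (auto intro!: Suc.IH[of "dir_deriv _ f" "dir_deriv _ g"])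
qed

text \<open>On an open set \<open>Ck_on\<close> depends only on the values taken there, so any
  explicit formula for the derivative on \<open>S\<close> may stand in for
  \<open>dir_deriv e f\<close>. Most closure properties below arise by feeding in a rule of
  differentiation.\<close>

lemma Ck_on_SucI:
  assumes "open S" "\<And>x. x \<in> S \<Longrightarrow> (f has_derivative f' x) (at x)"
    and "\<And>e. e \<in> Basis \<Longrightarrow> Ck_on k S (\<lambda>x. f' x e)"
  shows "Ck_on (Suc k) S f"
proof -
  have "Ck_on k S (dir_deriv e f)" if "e \<in> Basis" for e
    by (rule Ck_on_cong_open[OF assms(1) _ assms(3)[OF that]])
      (simp add: dir_deriv_eqI[OF assms(2)])
  then show ?thesis using assms(2) by (auto simp: differentiable_def)
qed

lemma Ck_on_has_derivative:
  assumes "Ck_on (Suc k) S f" "x \<in> S"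
  shows "(f has_derivative (\<lambda>v. dir_deriv v f x)) (at x)"
  using assms unfolding dir_deriv_def by (simp add: frechet_derivative_works)

lemma Ck_on_Suc_imp: "Ck_on (Suc k) S f \<Longrightarrow> Ck_on k S f"
proof (induction k arbitrary: f)
  case 0
  then show ?case
    by (simp add: differentiable_at_imp_differentiable_on differentiable_imp_continuous_on)
next
  case (Suc k)
  then show ?case by fastforce
qed

lemma Ck_on_imp_continuous_on: "Ck_on k S f \<Longrightarrow> continuous_on S f"
  by (induction k) (auto dest: Ck_on_Suc_imp simp del: Ck_on.simps(2))

lemma Ck_on_subset: "Ck_on k S f \<Longrightarrow> T \<subseteq> S \<Longrightarrow> Ck_on k T f"
  by (induction k arbitrary: f) (auto intro: continuous_on_subset)

lemma Ck_on_const: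
  assumes "open S" shows "Ck_on k S (\<lambda>_. c)"
proof (induction k arbitrary: c)
  case (Suc k)
  show ?case
    by (rule Ck_on_SucI[OF assms, of _ "\<lambda>x e. 0"]) (auto intro: Suc)
qed auto

lemma Ck_on_linear:
  assumes "bounded_linear L" "open S" "Ck_on k S f"
  shows "Ck_on k S (\<lambda>x. L (f x))"
  using assms(3)
proof (induction k arbitrary: f)
  case 0
  then show ?case using bounded_linear.continuous_on[OF assms(1)] by simp
next
  case (Suc k)
  show ?case
  proof (rule Ck_on_SucI[OF assms(2)])
    show "((\<lambda>x. L (f x)) has_derivative (\<lambda>v. L (dir_deriv v f x))) (at x)" if "x \<in> S" for x
      using bounded_linear.has_derivative[OF assms(1) Ck_on_has_derivative[OF Suc.prems that]] .
    show "Ck_on k S (\<lambda>x. L (dir_deriv e f x))" if "e \<in> Basis" for e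
      using Suc that by simp
  qed
qed

lemma Ck_on_add:
  assumes "open S" "Ck_on k S f" "Ck_on k S g"
  shows "Ck_on k S (\<lambda>x. f x + g x)"
  using assms(2,3)
proof (induction k arbitrary: f g)
  case 0
  then show ?case by (auto intro: continuous_intros)
next
  case (Suc k)
  show ?case
  proof (rule Ck_on_SucI[OF assms(1)])
    show "((\<lambda>x. f x + g x) has_derivative (\<lambda>v. dir_deriv v f x + dir_deriv v g x)) (at x)"
      if "x \<in> S" for x
      by (intro has_derivative_add Ck_on_has_derivative[OF Suc.prems(1) that]
          Ck_on_has_derivative[OF Suc.prems(2) that])
    show "Ck_on k S (\<lambda>x. dir_deriv e f x + dir_deriv e g x)" if "e \<in> Basis" for e
      using Suc that by simp
  qed
qed

lemma Ck_on_sum: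
  assumes "open S" "\<And>i. i \<in> A \<Longrightarrow> Ck_on k S (f i)"
  shows "Ck_on k S (\<lambda>x. \<Sum>i\<in>A. f i x)"
  using assms(2)
  by (induction A rule: infinite_finite_induct) (auto intro: Ck_on_const Ck_on_add assms(1))

lemma Ck_on_bilinear:
  assumes "bounded_bilinear B" "open S" "Ck_on k S f" "Ck_on k S g"
  shows "Ck_on k S (\<lambda>x. B (f x) (g x))"
  using assms(3,4)
proof (induction k arbitrary: f g)
  case 0
  then show ?case using bounded_bilinear.continuous_on[OF assms(1)] by simp
next
  case (Suc k)
  show ?case
  proof (rule Ck_on_SucI[OF assms(2)])
    show "((\<lambda>x. B (f x) (g x)) has_derivative
        (\<lambda>v. B (f x) (dir_deriv v g x) + B (dir_deriv v f x) (g x))) (at x)" if "x \<in> S" for x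
      by (intro bounded_bilinear.FDERIV[OF assms(1)] Ck_on_has_derivative[OF Suc.prems(1) that]
          Ck_on_has_derivative[OF Suc.prems(2) that])
    show "Ck_on k S (\<lambda>x. B (f x) (dir_deriv e g x) + B (dir_deriv e f x) (g x))"
      if "e \<in> Basis" for e
    proof (rule Ck_on_add[OF assms(2)])
      show "Ck_on k S (\<lambda>x. B (f x) (dir_deriv e g x))"
        using Suc.prems(2) that by (intro Suc.IH Ck_on_Suc_imp[OF Suc.prems(1)]) auto
      show "Ck_on k S (\<lambda>x. B (dir_deriv e f x) (g x))"
        using Suc.prems(1) that by (intro Suc.IH Ck_on_Suc_imp[OF Suc.prems(2)]) auto
    qed
  qed
qed

lemma dir_deriv_Basis_sum:
  fixes f :: "'a::euclidean_space \<Rightarrow> 'b::real_normed_vector"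
  assumes "f differentiable (at x)"
  shows "dir_deriv v f x = (\<Sum>b\<in>Basis. (v \<bullet> b) *\<^sub>R dir_deriv b f x)"
proof -
  have lin: "linear (frechet_derivative f (at x))"
    using linear_frechet_derivative[OF assms] .
  have "frechet_derivative f (at x) (\<Sum>b\<in>Basis. (v \<bullet> b) *\<^sub>R b)
      = (\<Sum>b\<in>Basis. (v \<bullet> b) *\<^sub>R frechet_derivative f (at x) b)"
    by (simp add: linear_sum[OF lin] linear_scale[OF lin])
  then show ?thesis by (simp add: euclidean_representation dir_deriv_def)
qed

text \<open>Chain rule. \<open>Ck_on\<close> controls only derivatives along \<open>Basis\<close>,
  so the derivative of \<open>F\<close> in the direction \<open>dir_deriv v G x\<close> is expanded
  over the basis. This leaves sums of products, and the induction hypothesis applies to the factors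
  \<open>dir_deriv b F (G x)\<close>.\<close>

lemma Ck_on_compose:
  assumes "open S" "G ` S \<subseteq> T" "Ck_on k T F" "Ck_on k S G"
  shows "Ck_on k S (\<lambda>x. F (G x))"
  using assms(3,4)
proof (induction k arbitrary: F)
  case 0
  then show ?case using assms(2) continuous_on_compose2[of T F S G] by simp
next
  case (Suc k)
  let ?D = "\<lambda>x v. \<Sum>b\<in>Basis. (dir_deriv v G x \<bullet> b) *\<^sub>R dir_deriv b F (G x)"
  show ?case
  proof (rule Ck_on_SucI[OF assms(1)])
    show "((\<lambda>x. F (G x)) has_derivative ?D x) (at x)" if "x \<in> S" for x
    proof -
      have "G x \<in> T" using that assms(2) by blast
      then have "((\<lambda>x. F (G x)) has_derivative (\<lambda>v. dir_deriv (dir_deriv v G x) F (G x))) (at x)"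
        by (intro has_derivative_compose[OF Ck_on_has_derivative[OF Suc.prems(2) that]]
            Ck_on_has_derivative[OF Suc.prems(1)])
      moreover have eq: "(\<lambda>v. dir_deriv (dir_deriv v G x) F (G x)) = ?D x"
        using \<open>G x \<in> T\<close> Suc.prems by (intro ext dir_deriv_Basis_sum) simp
      ultimately show ?thesis by (simp only: eq)
    qed
    show "Ck_on k S (\<lambda>x. ?D x e)" if "e \<in> Basis" for e
    proof (intro Ck_on_sum Ck_on_bilinear[OF bounded_bilinear_scaleR] assms(1))
      show "Ck_on k S (\<lambda>x. dir_deriv b F (G x))" if "b \<in> Basis" for b
        using Suc.prems(1) that by (intro Suc.IH Ck_on_Suc_imp[OF Suc.prems(2)]) auto
      show "Ck_on k S (\<lambda>x. dir_deriv e G x \<bullet> b)" for b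
        using Suc.prems(2) that
        by (intro Ck_on_linear[OF bounded_linear_inner_left] assms(1)) auto
    qed
  qed
qed

lemma Ck_on_holomorphic:
  assumes "open S" "f holomorphic_on S"
  shows "Ck_on k S f"
  using assms(2)
proof (induction k arbitrary: f)
  case 0
  then show ?case by (simp add: holomorphic_on_imp_continuous_on)
next
  case (Suc k)
  show ?case
  proof (rule Ck_on_SucI[OF assms(1)])
    show "(f has_derivative (\<lambda>v. deriv f x * v)) (at x)" if "x \<in> S" for x
      using holomorphic_derivI[OF Suc.prems assms(1) that] by (simp add: has_field_derivative_def)
    show "Ck_on k S (\<lambda>x. deriv f x * e)" for e
      by (intro Suc.IH holomorphic_intros holomorphic_deriv Suc.prems assms(1))
  qed
qed

section \<open>Smoothness near a point, and on a fixed open set\<close>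

lemma smooth_near_linear:
  assumes "bounded_linear L" "smooth_near x f"
  shows "smooth_near x (\<lambda>x. L (f x))"
  using assms Ck_on_linear unfolding smooth_near_def by blast

lemma smooth_near_bilinear:
  assumes "bounded_bilinear B" "smooth_near x f" "smooth_near x g"
  shows "smooth_near x (\<lambda>x. B (f x) (g x))"
proof -
  obtain S T where ST: "open S" "x \<in> S" "\<And>k. Ck_on k S f" "open T" "x \<in> T" "\<And>k. Ck_on k T g"
    using assms(2,3) unfolding smooth_near_def by blast
  then have "Ck_on k (S \<inter> T) (\<lambda>x. B (f x) (g x))" for k
    using Ck_on_subset[OF ST(3)[of k], of "S \<inter> T"] Ck_on_subset[OF ST(6)[of k], of "S \<inter> T"]
    by (intro Ck_on_bilinear[OF assms(1)]) auto
  then show ?thesis using ST(1,2,4,5) unfolding smooth_near_def by (intro exI[of _ "S \<inter> T"]) auto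
qed

lemma smooth_near_add:
  assumes "smooth_near x f" "smooth_near x g"
  shows "smooth_near x (\<lambda>x. f x + g x)"
proof -
  obtain S T where ST: "open S" "x \<in> S" "\<And>k. Ck_on k S f" "open T" "x \<in> T" "\<And>k. Ck_on k T g"
    using assms unfolding smooth_near_def by blast
  then have "Ck_on k (S \<inter> T) (\<lambda>x. f x + g x)" for k
    using Ck_on_subset[OF ST(3)[of k], of "S \<inter> T"] Ck_on_subset[OF ST(6)[of k], of "S \<inter> T"]
    by (intro Ck_on_add) auto
  then show ?thesis using ST(1,2,4,5) unfolding smooth_near_def by (intro exI[of _ "S \<inter> T"]) auto
qed

lemma smooth_near_Pair:
  assumes "smooth_near x f" "smooth_near x g"
  shows "smooth_near x (\<lambda>x. (f x, g x))"
proof -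
  have "smooth_near x (\<lambda>x. (f x, 0) + (0, g x))"
    by (intro smooth_near_add smooth_near_linear[OF _ assms(1)] smooth_near_linear[OF _ assms(2)]
        bounded_linear_Pair bounded_linear_ident bounded_linear_zero)
  then show ?thesis by simp
qed

lemma smooth_near_compose:
  assumes "smooth_near (G x) F" "smooth_near x G"
  shows "smooth_near x (\<lambda>x. F (G x))"
proof -
  obtain S T where ST: "open S" "x \<in> S" "\<And>k. Ck_on k S G" "open T" "G x \<in> T" "\<And>k. Ck_on k T F"
    using assms unfolding smooth_near_def by blast
  let ?U = "S \<inter> G -` T"
  have "open ?U"
    by (rule continuous_open_preimage[OF Ck_on_imp_continuous_on[OF ST(3)] ST(1,4)])
  moreover have "Ck_on k ?U (\<lambda>x. F (G x))" for k
    using Ck_on_subset[OF ST(3)[of k], of ?U] by (intro Ck_on_compose[OF \<open>open ?U\<close> _ ST(6)]) auto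
  ultimately show ?thesis using ST(2,5) unfolding smooth_near_def by (intro exI[of _ ?U]) auto
qed

lemma smooth_near_holomorphic:
  assumes "open S" "x \<in> S" "f holomorphic_on S"
  shows "smooth_near x f"
  unfolding smooth_near_def by (intro exI[of _ S] conjI allI assms Ck_on_holomorphic)

text \<open>With one open set fixed, basis derivatives of every order stay smooth on that same set,
  so operators can be iterated without shrinking neighbourhoods.\<close>

definition smooth_on ::
  "'a::euclidean_space set \<Rightarrow> ('a \<Rightarrow> 'b::real_normed_vector) \<Rightarrow> bool" where
  "smooth_on S f \<longleftrightarrow> open S \<and> (\<forall>k. Ck_on k S f)"

lemma smooth_onD:
  assumes "smooth_on S f"
  shows "open S" "Ck_on k S f"
  using assms by (auto simp: smooth_on_def)

lemma smooth_near_smooth_on: "smooth_near x f \<longleftrightarrow> (\<exists>S. x \<in> S \<and> smooth_on S f)"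
  unfolding smooth_near_def smooth_on_def by auto

lemma smooth_on_differentiable: "smooth_on S f \<Longrightarrow> x \<in> S \<Longrightarrow> f differentiable (at x)"
  using smooth_onD(2)[of S f "Suc 0"] by simp

lemma smooth_on_has_derivative:
  "smooth_on S f \<Longrightarrow> x \<in> S \<Longrightarrow> (f has_derivative (\<lambda>v. dir_deriv v f x)) (at x)"
  using Ck_on_has_derivative[OF smooth_onD(2)] .

lemma smooth_on_cong:
  assumes "smooth_on S f" "\<And>x. x \<in> S \<Longrightarrow> f x = g x"
  shows "smooth_on S g"
  unfolding smooth_on_def
proof (intro conjI allI)
  show "Ck_on k S g" for k
    by (rule Ck_on_cong_open[OF smooth_onD(1)[OF assms(1)] assms(2) smooth_onD(2)[OF assms(1)]])
qed (rule smooth_onD[OF assms(1)])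

lemma smooth_on_dir_deriv_Basis:
  assumes "smooth_on S f" "b \<in> Basis"
  shows "smooth_on S (dir_deriv b f)"
  using smooth_onD(1)[OF assms(1)] smooth_onD(2)[OF assms(1), of "Suc k" for k] assms(2)
  unfolding smooth_on_def by simp

lemma smooth_on_linear:
  assumes "bounded_linear L" "smooth_on S f"
  shows "smooth_on S (\<lambda>x. L (f x))"
  using assms Ck_on_linear[OF assms(1)] unfolding smooth_on_def by blast

section \<open>Constant-coefficient operators and Taylor terms\<close>

text \<open>On smooth functions, both \<open>dir_deriv v\<close> and the Wirtinger derivative are of this form.\<close>

definition diff_op ::
  "('a::euclidean_space \<Rightarrow> 'b::real_normed_field) \<Rightarrow> ('a \<Rightarrow> 'b) \<Rightarrow> 'a \<Rightarrow> 'b" where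
  "diff_op c f x = (\<Sum>b\<in>Basis. c b * dir_deriv b f x)"

lemma smooth_on_linear_comb:
  fixes g :: "'i \<Rightarrow> 'a::euclidean_space \<Rightarrow> 'b::real_normed_field"
  assumes "open S" "\<And>i. i \<in> A \<Longrightarrow> smooth_on S (g i)"
  shows "smooth_on S (\<lambda>x. \<Sum>i\<in>A. d i * g i x)"
  unfolding smooth_on_def
  by (intro conjI allI Ck_on_sum assms(1) Ck_on_linear[OF bounded_linear_mult_right]
      smooth_onD(2)[OF assms(2)])

lemma smooth_on_diff_op: "smooth_on S f \<Longrightarrow> smooth_on S (diff_op c f)"
  using smooth_on_linear_comb[of S Basis "\<lambda>b. dir_deriv b f" c]
  by (simp add: smooth_on_dir_deriv_Basis smooth_onD(1) diff_op_def[abs_def])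

lemma smooth_on_diff_op_funpow: "smooth_on S f \<Longrightarrow> smooth_on S ((diff_op c ^^ m) f)"
  by (induction m) (auto intro: smooth_on_diff_op)

lemma dir_deriv_cong:
  assumes "smooth_on S f" "\<And>y. y \<in> S \<Longrightarrow> f y = g y" "x \<in> S"
  shows "dir_deriv v f x = dir_deriv v g x"
  using dir_deriv_cong_open(2)[OF smooth_onD(1)[OF assms(1)] assms(3,2)]
    smooth_on_differentiable[OF assms(1,3)] by simp

lemma diff_op_cong:
  assumes "smooth_on S f" "\<And>y. y \<in> S \<Longrightarrow> f y = g y" "x \<in> S"
  shows "diff_op c f x = diff_op c g x"
  unfolding diff_op_def using dir_deriv_cong[OF assms] by simp

lemma diff_op_funpow_cong:
  assumes "smooth_on S f" "\<And>y. y \<in> S \<Longrightarrow> f y = g y" "x \<in> S"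
  shows "(diff_op c ^^ m) f x = (diff_op c ^^ m) g x"
  using assms(3)
proof (induction m arbitrary: x)
  case (Suc m)
  show ?case
    using diff_op_cong[OF smooth_on_diff_op_funpow[OF assms(1)] Suc.IH Suc.prems] by simp
qed (use assms(2) in simp)

lemma dir_deriv_linear_comb:
  fixes g :: "'i \<Rightarrow> 'a::euclidean_space \<Rightarrow> 'b::real_normed_field"
  assumes "\<And>i. i \<in> A \<Longrightarrow> g i differentiable (at x)"
  shows "dir_deriv v (\<lambda>x. \<Sum>i\<in>A. d i * g i x) x = (\<Sum>i\<in>A. d i * dir_deriv v (g i) x)"
proof (rule dir_deriv_eqI)
  show "((\<lambda>x. \<Sum>i\<in>A. d i * g i x) has_derivative (\<lambda>v. \<Sum>i\<in>A. d i * dir_deriv v (g i) x)) (at x)"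
    using assms unfolding dir_deriv_def
    by (intro has_derivative_sum has_derivative_mult_right) (simp add: frechet_derivative_works)
qed

lemma diff_op_linear_comb:
  fixes g :: "'i \<Rightarrow> 'a::euclidean_space \<Rightarrow> 'b::real_normed_field"
  assumes "\<And>i. i \<in> A \<Longrightarrow> g i differentiable (at x)"
  shows "diff_op c (\<lambda>x. \<Sum>i\<in>A. d i * g i x) x = (\<Sum>i\<in>A. d i * diff_op c (g i) x)"
proof -
  have "dir_deriv v (\<lambda>x. \<Sum>i\<in>A. d i * g i x) x = (\<Sum>i\<in>A. d i * dir_deriv v (g i) x)" for v
    by (rule dir_deriv_linear_comb) (rule assms)
  then show ?thesis
    unfolding diff_op_def by (simp add: sum_distrib_left mult.left_commute) (rule sum.swap)
qed

lemma diff_op_funpow_linear_comb: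
  fixes g :: "'i \<Rightarrow> 'a::euclidean_space \<Rightarrow> 'b::real_normed_field"
  assumes "open S" "\<And>i. i \<in> A \<Longrightarrow> smooth_on S (g i)" "x \<in> S"
  shows "(diff_op c ^^ m) (\<lambda>x. \<Sum>i\<in>A. d i * g i x) x = (\<Sum>i\<in>A. d i * (diff_op c ^^ m) (g i) x)"
  using assms(3)
proof (induction m arbitrary: x)
  case (Suc m)
  have "(diff_op c ^^ Suc m) (\<lambda>x. \<Sum>i\<in>A. d i * g i x) x
      = diff_op c (\<lambda>x. \<Sum>i\<in>A. d i * (diff_op c ^^ m) (g i) x) x"
    using diff_op_cong[OF smooth_on_diff_op_funpow[OF smooth_on_linear_comb[OF assms(1,2)]]
        Suc.IH Suc.prems] by simp
  also have "\<dots> = (\<Sum>i\<in>A. d i * (diff_op c ^^ Suc m) (g i) x)"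
    using smooth_on_differentiable[OF smooth_on_diff_op_funpow[OF assms(2)] Suc.prems]
    by (simp add: diff_op_linear_comb)
  finally show ?case .
qed simp

text \<open>The coefficients are constant, so powers of the operator pass through linear
  combinations and one differentiation can be kept innermost. Inductions on \<open>m\<close> may
  then replace \<open>f\<close> by its partial derivatives.\<close>

lemma diff_op_funpow_Suc:
  assumes "smooth_on S f" "x \<in> S"
  shows "(diff_op c ^^ Suc m) f x = (\<Sum>b\<in>Basis. c b * (diff_op c ^^ m) (dir_deriv b f) x)"
proof -
  have "(diff_op c ^^ Suc m) f x = (diff_op c ^^ m) (diff_op c f) x"
    by (simp add: funpow_swap1)
  also have "diff_op c f = (\<lambda>x. \<Sum>b\<in>Basis. c b * dir_deriv b f x)"
    by (rule ext) (rule diff_op_def)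
  also have "(diff_op c ^^ m) \<dots> x = (\<Sum>b\<in>Basis. c b * (diff_op c ^^ m) (dir_deriv b f) x)"
    by (rule diff_op_funpow_linear_comb[OF smooth_onD(1)[OF assms(1)] _ assms(2)])
      (rule smooth_on_dir_deriv_Basis[OF assms(1)])
  finally show ?thesis .
qed

text \<open>The derivative is linear in its direction, which yields the coefficients
  \<open>v \<bullet> b\<close>. The dependence on \<open>v\<close> thereby becomes explicit.\<close>

lemma dir_deriv_funpow_eq_diff_op:
  fixes f :: "'a::euclidean_space \<Rightarrow> 'b::real_normed_field"
  assumes "smooth_on S f" "x \<in> S"
  shows "(dir_deriv v ^^ m) f x = (diff_op (\<lambda>b. of_real (v \<bullet> b)) ^^ m) f x"
  using assms(2)
proof (induction m arbitrary: x)
  case (Suc m)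
  let ?g = "(diff_op (\<lambda>b. of_real (v \<bullet> b)) ^^ m) f"
  have g: "smooth_on S ?g" using assms(1) by (rule smooth_on_diff_op_funpow)
  have "dir_deriv v ((dir_deriv v ^^ m) f) x = dir_deriv v ?g x"
    by (rule dir_deriv_cong[OF g _ Suc.prems, symmetric]) (simp add: Suc.IH)
  also have "\<dots> = diff_op (\<lambda>b. of_real (v \<bullet> b)) ?g x"
    by (subst dir_deriv_Basis_sum[OF smooth_on_differentiable[OF g Suc.prems]])
      (simp add: diff_op_def scaleR_conv_of_real)
  finally show ?case by simp
qed simp

lemma smooth_on_dir_deriv_funpow:
  fixes f :: "'a::euclidean_space \<Rightarrow> 'b::real_normed_field"
  assumes "smooth_on S f"
  shows "smooth_on S ((dir_deriv v ^^ m) f)"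
  by (rule smooth_on_cong[OF smooth_on_diff_op_funpow[OF assms]])
    (simp add: dir_deriv_funpow_eq_diff_op[OF assms])

lemma diff_op_funpow_of_real:
  fixes f :: "'a::euclidean_space \<Rightarrow> real"
  assumes "smooth_on S f" "x \<in> S"
  shows "(diff_op (\<lambda>b. of_real (c b)) ^^ m) (\<lambda>x. of_real (f x) :: 'b::real_normed_field) x
    = of_real ((diff_op c ^^ m) f x)"
  using assms(1)
proof (induction m arbitrary: f)
  case (Suc m)
  have of_real: "smooth_on S (\<lambda>x. of_real (g x) :: 'b)" if "smooth_on S g" for g
    using smooth_on_linear[OF bounded_linear_of_real that] .
  have *: "dir_deriv b (\<lambda>x. of_real (f x) :: 'b) y = of_real (dir_deriv b f y)" if "y \<in> S" for b y
    using bounded_linear.has_derivative[OF bounded_linear_of_real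
        smooth_on_has_derivative[OF Suc.prems that]]
    by (rule dir_deriv_eqI)
  have "(diff_op (\<lambda>b. of_real (c b)) ^^ m) (dir_deriv b (\<lambda>x. of_real (f x) :: 'b)) x
      = of_real ((diff_op c ^^ m) (dir_deriv b f) x)" if "b \<in> Basis" for b
  proof -
    have "(diff_op (\<lambda>b. of_real (c b)) ^^ m) (dir_deriv b (\<lambda>x. of_real (f x) :: 'b)) x
        = (diff_op (\<lambda>b. of_real (c b)) ^^ m) (\<lambda>x. of_real (dir_deriv b f x) :: 'b) x"
      by (intro diff_op_funpow_cong[OF smooth_on_dir_deriv_Basis[OF of_real[OF Suc.prems] that]]
          * assms(2))
    then show ?thesis
      by (simp add: Suc.IH[OF smooth_on_dir_deriv_Basis[OF Suc.prems that]])
  qed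
  then show ?case
    by (simp add: diff_op_funpow_Suc[OF of_real[OF Suc.prems] assms(2)]
        diff_op_funpow_Suc[OF Suc.prems assms(2)] del: funpow.simps)
qed simp

text \<open>Continuity is joint in direction and point, as needed for limits in which both move. It
  follows by induction because the direction enters only through the coefficients
  \<open>v \<bullet> b\<close>.\<close>

lemma continuous_on_dir_deriv_funpow:
  fixes f :: "'a::euclidean_space \<Rightarrow> real"
  assumes "smooth_on S f"
  shows "continuous_on (UNIV \<times> S) (\<lambda>(v, x). (dir_deriv v ^^ m) f x)"
proof -
  have "continuous_on (UNIV \<times> S) (\<lambda>(v, x). (diff_op (\<lambda>b. v \<bullet> b) ^^ m) f x)"
    using assms
  proof (induction m arbitrary: f)
    case 0
    have "continuous_on S f" using smooth_onD(2)[OF 0] Ck_on_imp_continuous_on by blast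
    then show ?case
      by (auto simp: case_prod_unfold intro!: continuous_on_compose2[of S f] continuous_intros)
  next
    case (Suc m)
    have "continuous_on (UNIV \<times> S)
        (\<lambda>p. \<Sum>b\<in>Basis. (fst p \<bullet> b) * (diff_op (\<lambda>b. fst p \<bullet> b) ^^ m) (dir_deriv b f) (snd p))"
      using Suc.IH[OF smooth_on_dir_deriv_Basis[OF Suc.prems]]
      by (intro continuous_intros) (simp add: case_prod_unfold)
    then show ?case
      by (rule continuous_on_eq) (auto simp: diff_op_funpow_Suc[OF Suc.prems] simp del: funpow.simps)
  qed
  then show ?thesis
    by (rule continuous_on_eq) (auto simp: dir_deriv_funpow_eq_diff_op[OF assms])
qed

section \<open>Taylor terms as limits along lines and curves\<close>

text \<open>Lagrange remainder for the one-variable function \<open>f (t *\<^sub>R v)\<close> of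
  \<open>t\<close>, whose derivatives are the iterated directional derivatives of
  \<open>f\<close>.\<close>

lemma Maclaurin_along_line:
  fixes f :: "'a::euclidean_space \<Rightarrow> real"
  assumes "smooth_on S f" "\<And>t. \<bar>t\<bar> \<le> \<bar>r\<bar> \<Longrightarrow> t *\<^sub>R v \<in> S"
  shows "\<exists>t. \<bar>t\<bar> \<le> \<bar>r\<bar> \<and>
    f (r *\<^sub>R v) = (\<Sum>i<m. taylor_term f i v * r ^ i) + (dir_deriv v ^^ m) f (t *\<^sub>R v) / fact m * r ^ m"
proof -
  have "DERIV (\<lambda>t. (dir_deriv v ^^ i) f (t *\<^sub>R v)) t :> (dir_deriv v ^^ Suc i) f (t *\<^sub>R v)"
    if "\<bar>t\<bar> \<le> \<bar>r\<bar>" for i t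
  proof -
    let ?g = "(dir_deriv v ^^ i) f"
    have D: "(?g has_derivative (\<lambda>u. dir_deriv u ?g (t *\<^sub>R v))) (at (t *\<^sub>R v))"
      using smooth_on_has_derivative[OF smooth_on_dir_deriv_funpow[OF assms(1)] assms(2)[OF that]] .
    have "((\<lambda>t. ?g (t *\<^sub>R v)) has_derivative (\<lambda>s. dir_deriv (s *\<^sub>R v) ?g (t *\<^sub>R v))) (at t)"
      by (rule has_derivative_compose[of "\<lambda>t. t *\<^sub>R v" "\<lambda>s. s *\<^sub>R v" t UNIV, OF _ D])
        (auto intro!: derivative_eq_intros)
    moreover have "dir_deriv (s *\<^sub>R v) ?g (t *\<^sub>R v) = dir_deriv v ?g (t *\<^sub>R v) * s" for s
      using linear_scale[OF has_derivative_linear[OF D]] by simp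
    ultimately show ?thesis by (simp add: has_field_derivative_def)
  qed
  then show ?thesis
    using Maclaurin_bi_le[of "\<lambda>i t. (dir_deriv v ^^ i) f (t *\<^sub>R v)" "\<lambda>t. f (t *\<^sub>R v)" m r]
    by (simp add: taylor_term_def)
qed

text \<open>The lower terms vanish, so the Maclaurin formula leaves only its remainder, and joint
  continuity gives the limit. The direction \<open>w t\<close> may vary with \<open>t\<close>, so
  that the lemma covers \<open>P\<close> along a holomorphic curve as well as along a ray.\<close>

lemma tendsto_taylor_term:
  fixes f :: "'a::euclidean_space \<Rightarrow> real" and w :: "real \<Rightarrow> 'a"
  assumes "smooth_near 0 f" "\<And>i v. i < m \<Longrightarrow> taylor_term f i v = 0"
    and "(r \<longlongrightarrow> 0) (at_right 0)" "\<And>t. t > 0 \<Longrightarrow> r t \<noteq> 0" "(w \<longlongrightarrow> v) (at_right 0)"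
  shows "((\<lambda>t. f (r t *\<^sub>R w t) / r t ^ m) \<longlongrightarrow> taylor_term f m v) (at_right 0)"
proof -
  obtain S where S: "0 \<in> S" "smooth_on S f"
    using assms(1) unfolding smooth_near_smooth_on by blast
  obtain e where e: "e > 0" "ball 0 e \<subseteq> S"
    using S smooth_onD(1) open_contains_ball by blast
  \<comment> \<open>\<open>\<theta> t\<close> is the intermediate point of the Maclaurin remainder,
    chosen as a function of \<open>t\<close>; the bound by \<open>r t\<close> forces it to
    0.\<close>
  define \<theta> where "\<theta> t = (SOME s. \<bar>s\<bar> \<le> \<bar>r t\<bar> \<and>
      f (r t *\<^sub>R w t) = (dir_deriv (w t) ^^ m) f (s *\<^sub>R w t) / fact m * r t ^ m)" for t
  have "((\<lambda>t. norm (r t *\<^sub>R w t)) \<longlongrightarrow> norm (0 *\<^sub>R v)) (at_right 0)"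
    using assms(3,5) by (intro tendsto_intros)
  then have "\<forall>\<^sub>F t in at_right 0. norm (r t *\<^sub>R w t) < e"
    using e(1) by (auto dest: order_tendstoD(2))
  moreover have "\<forall>\<^sub>F t in at_right 0. t > (0::real)"
    by (simp add: eventually_at_right_less)
  ultimately have ev: "\<forall>\<^sub>F t in at_right 0. t > 0 \<and> \<bar>\<theta> t\<bar> \<le> \<bar>r t\<bar> \<and> \<theta> t *\<^sub>R w t \<in> S \<and>
      f (r t *\<^sub>R w t) = (dir_deriv (w t) ^^ m) f (\<theta> t *\<^sub>R w t) / fact m * r t ^ m"
  proof eventually_elim
    case (elim t)
    have in_S: "s *\<^sub>R w t \<in> S" if "\<bar>s\<bar> \<le> \<bar>r t\<bar>" for s
    proof -
      have "norm (s *\<^sub>R w t) \<le> norm (r t *\<^sub>R w t)" using that by (simp add: mult_right_mono)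
      then show ?thesis using elim e by auto
    qed
    show ?case
      using someI_ex[OF Maclaurin_along_line[OF S(2) in_S, of "r t" m, simplified assms(2) mult_zero_left]]
        in_S elim unfolding \<theta>_def by (simp add: assms(2))
  qed
  have \<theta>: "(\<theta> \<longlongrightarrow> 0) (at_right 0)"
    by (rule Lim_null_comparison[OF _ tendsto_rabs_zero[OF assms(3)]])
      (use ev in eventually_elim, auto)
  have "isCont (\<lambda>(v, x). (dir_deriv v ^^ m) f x) (v, 0)"
    using continuous_on_dir_deriv_funpow[OF S(2), of m] S smooth_onD(1)[OF S(2)]
    by (auto simp: continuous_on_eq_continuous_at open_Times)
  moreover have "((\<lambda>t. (w t, \<theta> t *\<^sub>R w t)) \<longlongrightarrow> (v, 0 *\<^sub>R v)) (at_right 0)"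
    by (intro tendsto_intros assms \<theta>)
  ultimately have "((\<lambda>t. (dir_deriv (w t) ^^ m) f (\<theta> t *\<^sub>R w t)) \<longlongrightarrow> (dir_deriv v ^^ m) f 0) (at_right 0)"
    using isCont_tendsto_compose by fastforce
  then have "((\<lambda>t. (dir_deriv (w t) ^^ m) f (\<theta> t *\<^sub>R w t) / fact m) \<longlongrightarrow> taylor_term f m v) (at_right 0)"
    unfolding taylor_term_def by (intro tendsto_intros) auto
  then show ?thesis
    by (rule Lim_transform_eventually) (use ev in eventually_elim, auto simp: assms(4))
qed

section \<open>From real directions to the Wirtinger derivative\<close>

text \<open>Real values of \<open>\<beta>\<close> give real directional derivatives and
  \<open>\<beta> = - \<i>/2\<close> gives the Wirtinger derivative. Being polynomial in
  \<open>\<beta>\<close> is what allows passing from the former to the latter.\<close>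

lemma diff_op_funpow_poly:
  fixes f :: "complex \<Rightarrow> complex"
  assumes "smooth_on S f" "x \<in> S"
  shows "\<exists>p. \<forall>\<beta>. (diff_op (\<lambda>b. if b = 1 then 1/2 else \<beta>) ^^ m) f x = poly p \<beta>"
  using assms(1)
proof (induction m arbitrary: f)
  case 0
  show ?case by (rule exI[of _ "[:f x:]"]) simp
next
  case (Suc m)
  obtain p where p: "(diff_op (\<lambda>b. if b = 1 then 1/2 else \<beta>) ^^ m) (dir_deriv 1 f) x = poly p \<beta>" for \<beta>
    using Suc.IH[OF smooth_on_dir_deriv_Basis[OF Suc.prems, of 1]] by (auto simp: Basis_complex_def)
  obtain q where q: "(diff_op (\<lambda>b. if b = 1 then 1/2 else \<beta>) ^^ m) (dir_deriv \<i> f) x = poly q \<beta>" for \<beta>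
    using Suc.IH[OF smooth_on_dir_deriv_Basis[OF Suc.prems, of \<i>]] by (auto simp: Basis_complex_def)
  show ?case
    by (rule exI[of _ "smult (1/2) p + pCons 0 q"])
      (simp add: diff_op_funpow_Suc[OF Suc.prems assms(2)] Basis_complex_def p q del: funpow.simps)
qed

lemma wirtinger_eq_diff_op: "wirtinger = diff_op (\<lambda>b. if b = 1 then 1/2 else - \<i>/2)"
  by (intro ext) (simp add: wirtinger_def diff_op_def Basis_complex_def field_simps)

text \<open>For \<open>w = 1/2 + \<i> b\<close> with \<open>b\<close> real, \<open>taylor_term f m w\<close> is a polynomial in \<open>b\<close>, and at
  \<open>b = - \<i>/2\<close> that polynomial takes the value of the pure Wirtinger derivative (over \<open>m!\<close>), while
  \<open>1/2 + \<i> b\<close> becomes \<open>1\<close> and its formal conjugate \<open>1/2 - \<i> b\<close> becomes \<open>0\<close>.\<close>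

lemma taylor_term_harmonic_imp_zero:
  assumes "smooth_near 0 f" "m > 0"
    and "(wirtinger ^^ m) (\<lambda>z. complex_of_real (f z)) 0 = 0"
    and harm: "\<And>w. taylor_term f m w = Re (a * w ^ m)"
  shows "a = 0"
proof -
  obtain S where S: "0 \<in> S" "smooth_on S f"
    using assms(1) unfolding smooth_near_smooth_on by blast
  let ?F = "\<lambda>z. complex_of_real (f z)"
  have F: "smooth_on S ?F" by (rule smooth_on_linear[OF bounded_linear_of_real S(2)])
  obtain p where p: "(diff_op (\<lambda>b. if b = 1 then 1/2 else \<beta>) ^^ m) ?F 0 = poly p \<beta>" for \<beta>
    using diff_op_funpow_poly[OF F S(1)] by blast
  \<comment> \<open>\<open>Re (a * w ^ m)\<close> is half the sum of \<open>a * w ^ m\<close> and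
    its conjugate, with \<open>w\<close> and \<open>cnj w\<close> written as polynomials in the
    imaginary part of \<open>w\<close>. The factor \<open>fact m\<close> undoes the normalisation of
    \<open>taylor_term\<close>.\<close>
  define q where
    "q = smult (fact m / 2) (smult a ([:1/2, \<i>:] ^ m) + smult (cnj a) ([:1/2, - \<i>:] ^ m))"
  have "poly p (of_real b) = poly q (of_real b)" for b
  proof -
    let ?w = "Complex (1/2) b"
    have "diff_op (\<lambda>e. complex_of_real (?w \<bullet> e)) = diff_op (\<lambda>e. if e = 1 then 1/2 else of_real b)"
      by (intro ext) (simp add: diff_op_def Basis_complex_def)
    then have "poly p (of_real b) = of_real ((dir_deriv ?w ^^ m) f 0)"
      using diff_op_funpow_of_real[OF S(2,1), where c="\<lambda>e. ?w \<bullet> e" and m=m and 'b=complex]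
        dir_deriv_funpow_eq_diff_op[OF S(2,1), where v="?w" and m=m] p by simp
    also have "(dir_deriv ?w ^^ m) f 0 = fact m * Re (a * ?w ^ m)"
      using harm[of ?w] unfolding taylor_term_def by (simp add: divide_eq_eq mult.commute)
    also have "complex_of_real \<dots> = fact m * complex_of_real (Re (a * ?w ^ m))"
      by simp
    also have "\<dots> = fact m / 2 * (a * ?w ^ m + cnj (a * ?w ^ m))"
      by (simp only: complex_add_cnj) simp
    also have "\<dots> = poly q (of_real b)"
    proof -
      have w: "?w = 1/2 + \<i> * of_real b" "cnj ?w = 1/2 - \<i> * of_real b"
        by (simp_all add: complex_eq_iff)
      show ?thesis unfolding q_def
        by (simp add: w mult.commute)
    qed
    finally show ?thesis .
  qed
  \<comment> \<open>Two polynomials that agree on the infinite set of reals are equal, hence also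
    agree at the non-real point \<open>- \<i>/2\<close>.\<close>
  then have "range complex_of_real \<subseteq> {z. poly (p - q) z = 0}" by auto
  moreover have "infinite (range complex_of_real)"
    by (simp add: finite_image_iff inj_of_real infinite_UNIV_char_0)
  ultimately have "p = q"
    using poly_roots_finite[of "p - q"] finite_subset by (metis right_minus_eq)
  have "poly q (- \<i>/2) = fact m / 2 * a"
    using assms(2) by (simp add: q_def)
  moreover have "poly p (- \<i>/2) = 0"
    using assms(3) p[of "- \<i>/2"] by (simp add: wirtinger_eq_diff_op)
  ultimately show ?thesis using \<open>p = q\<close> by simp
qed

section \<open>Orders of vanishing\<close>

text \<open>Strong induction on the degree: once all lower terms vanish, the limit along a ray is
  the Taylor term itself.\<close>

lemma taylor_term_eq_zero_if_limits_zero: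
  fixes f :: "'a::euclidean_space \<Rightarrow> real"
  assumes "smooth_near 0 f"
    and "\<And>i v. i < N \<Longrightarrow> ((\<lambda>t. f (t *\<^sub>R v) / t ^ i) \<longlongrightarrow> 0) (at_right 0)" "i < N"
  shows "taylor_term f i v = 0"
  using assms(3)
proof (induction i arbitrary: v rule: less_induct)
  case (less i)
  have "((\<lambda>t. f (t *\<^sub>R v) / t ^ i) \<longlongrightarrow> taylor_term f i v) (at_right 0)"
    using less by (intro tendsto_taylor_term[OF assms(1)]) (auto intro: tendsto_eq_intros)
  then show ?case
    using tendsto_unique assms(2)[OF less.prems] trivial_limit_at_right_real by blast
qed

lemma vanish_order_ge_iff: "enat N \<le> vanish_order f \<longleftrightarrow> (\<forall>i<N. \<forall>v. taylor_term f i v = 0)"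
proof (cases "\<forall>n v. taylor_term f n v = 0")
  case False
  let ?P = "\<lambda>n. \<exists>v. taylor_term f n v \<noteq> 0"
  define L where "L = (LEAST n. ?P n)"
  have "?P L"
    unfolding L_def by (rule LeastI_ex) (use False in blast)
  moreover have "\<not> ?P i" if "i < L" for i
    using not_less_Least that unfolding L_def .
  moreover have "vanish_order f = enat L"
    unfolding vanish_order_def L_def using False by (rule if_not_P)
  ultimately show ?thesis
    by (cases "N \<le> L") (auto simp: not_le)
qed (auto simp: vanish_order_def)

lemma vanish_order_eq_enat:
  assumes "vanish_order f = enat m"
  shows "\<exists>v. taylor_term f m v \<noteq> 0" "\<And>i v. i < m \<Longrightarrow> taylor_term f i v = 0"
proof -
  show "\<And>i v. i < m \<Longrightarrow> taylor_term f i v = 0"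
    using vanish_order_ge_iff[of m f] assms by simp
  have "\<not> enat (Suc m) \<le> vanish_order f" using assms by simp
  then show "\<exists>v. taylor_term f m v \<noteq> 0"
    unfolding vanish_order_ge_iff by (metis assms enat_ord_simps(1) less_SucE order_refl vanish_order_ge_iff)
qed

lemma vanish_order_map_ge_iff:
  "n \<le> vanish_order_map f \<longleftrightarrow> (\<forall>e\<in>Basis. n \<le> vanish_order (\<lambda>x. f x \<bullet> e))"
  unfolding vanish_order_map_def by (subst Min_ge_iff) auto

section \<open>Splitting powers of \<open>z\<close> off holomorphic functions\<close>

text \<open>The singularity of \<open>f z / z\<close> at 0 is removable, with value
  \<open>deriv f 0\<close>. Since the quotient is formed pointwise, the factorisation holds for all
  \<open>z\<close>, also outside \<open>S\<close>.\<close>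

lemma holomorphic_factor_id:
  assumes "open S" "f holomorphic_on S" "f 0 = 0"
  obtains g where "g holomorphic_on S" "\<And>z. f z = z * g z"
proof
  let ?g = "\<lambda>z. if z = 0 then deriv f 0 else f z / z"
  show "?g holomorphic_on S"
    using pole_lemma_open[OF assms(2,1), of 0] assms(3) by (simp cong: if_cong)
  show "f z = z * ?g z" for z using assms(3) by simp
qed

text \<open>One factor \<open>z\<close> is removed at a time until the quotient is nonzero at 0 or
  \<open>N\<close> factors are gone. Stopping at \<open>N\<close> covers functions that vanish
  identically near 0.\<close>

lemma holomorphic_factor_power:
  assumes "open S" "f holomorphic_on S"
  shows "(\<exists>j<N. \<exists>u. u holomorphic_on S \<and> u 0 \<noteq> 0 \<and> (\<forall>z. f z = z ^ j * u z)) \<or>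
    (\<exists>u. u holomorphic_on S \<and> (\<forall>z. f z = z ^ N * u z))"
proof (induction N)
  case (Suc N)
  have "(\<exists>j<Suc N. \<exists>u. u holomorphic_on S \<and> u 0 \<noteq> 0 \<and> (\<forall>z. f z = z ^ j * u z)) \<or>
    (\<exists>u. u holomorphic_on S \<and> (\<forall>z. f z = z ^ Suc N * u z))"
    if u: "u holomorphic_on S" "\<forall>z. f z = z ^ N * u z" for u
  proof (cases "u 0 = 0")
    case True
    obtain g where "g holomorphic_on S" "\<And>z. u z = z * g z"
      using holomorphic_factor_id[OF assms(1) u(1) True] by blast
    with u show ?thesis by (intro disjI2 exI[of _ g]) (auto simp: mult_ac)
  qed (use u in blast)
  with Suc show ?case using less_SucI by blast
qed (use assms in auto)

text \<open>The same process run on both components at once; it stops as soon as either quotient is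
  nonzero at 0, so \<open>k\<close> is the smaller of the two orders.\<close>

lemma holomorphic_pair_factor_power:
  assumes "open S" "f holomorphic_on S" "g holomorphic_on S"
  shows "(\<exists>k<N. \<exists>u w. u holomorphic_on S \<and> w holomorphic_on S \<and> (u 0, w 0) \<noteq> (0, 0) \<and>
      (\<forall>z. f z = z ^ k * u z \<and> g z = z ^ k * w z)) \<or>
    (\<exists>u w. u holomorphic_on S \<and> w holomorphic_on S \<and> (\<forall>z. f z = z ^ N * u z \<and> g z = z ^ N * w z))"
    (is "?A N \<or> ?B N")
proof (induction N)
  case (Suc N)
  have "?A (Suc N) \<or> ?B (Suc N)"
    if u: "u holomorphic_on S" "w holomorphic_on S" "\<forall>z. f z = z ^ N * u z \<and> g z = z ^ N * w z"
    for u w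
  proof (cases "u 0 = 0 \<and> w 0 = 0")
    case True
    obtain u' where "u' holomorphic_on S" "\<And>z. u z = z * u' z"
      using holomorphic_factor_id[OF assms(1) u(1)] True by blast
    moreover obtain w' where "w' holomorphic_on S" "\<And>z. w z = z * w' z"
      using holomorphic_factor_id[OF assms(1) u(2)] True by blast
    ultimately have "?B (Suc N)" using u by (intro exI[of _ u'] exI[of _ w']) (auto simp: mult_ac)
    then show ?thesis ..
  next
    case False
    have "?A (Suc N)" using u False by (intro exI[of _ N] exI[of _ u] exI[of _ w]) auto
    then show ?thesis ..
  qed
  moreover have "?A N \<Longrightarrow> ?A (Suc N)" using less_SucI by blast
  ultimately show ?case using Suc by blast
next
  case 0
  show ?case by (rule disjI2, rule exI[of _ f], rule exI[of _ g]) (use assms in auto)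
qed

lemma tendsto_along_ray:
  fixes u :: "complex \<Rightarrow> complex"
  assumes "open S" "0 \<in> S" "u holomorphic_on S"
  shows "((\<lambda>t. u (t *\<^sub>R v)) \<longlongrightarrow> u 0) (at_right 0)"
proof -
  have "isCont u 0"
    using assms holomorphic_on_imp_continuous_on continuous_on_eq_continuous_at by blast
  moreover have "((\<lambda>t. t *\<^sub>R v) \<longlongrightarrow> 0) (at_right (0::real))"
    by (auto intro!: tendsto_eq_intros)
  ultimately show ?thesis by (rule isCont_tendsto_compose)
qed

lemma vanish_order_map_ge_of_factor:
  fixes h :: "complex \<Rightarrow> complex \<times> complex"
  assumes "open S" "0 \<in> S" "u holomorphic_on S" "w holomorphic_on S"
    and h: "\<And>z. h z = (z ^ N * u z, z ^ N * w z)"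
  shows "enat N \<le> vanish_order_map h"
  unfolding vanish_order_map_ge_iff vanish_order_ge_iff
proof (intro ballI allI impI)
  fix e :: "complex \<times> complex" and i v assume "i < N"
  show "taylor_term (\<lambda>z. h z \<bullet> e) i v = 0"
  proof (rule taylor_term_eq_zero_if_limits_zero[OF _ _ \<open>i < N\<close>])
    have "smooth_near 0 h"
      unfolding h using assms
      by (intro smooth_near_Pair smooth_near_holomorphic[of S]) (auto intro!: holomorphic_intros)
    then show "smooth_near 0 (\<lambda>z. h z \<bullet> e)"
      by (rule smooth_near_linear[OF bounded_linear_inner_left])
    fix i v assume "i < N"
    note c = tendsto_along_ray[OF assms(1,2,3), of v] tendsto_along_ray[OF assms(1,2,4), of v]
    \<comment> \<open>Dividing by \<open>t ^ i\<close> with \<open>i < N\<close> leaves the positive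
      power \<open>t ^ (N - i)\<close>, which drives the limit to 0.\<close>
    have "((\<lambda>t. (t ^ (N - i) *\<^sub>R (v ^ N * u (t *\<^sub>R v), v ^ N * w (t *\<^sub>R v))) \<bullet> e) \<longlongrightarrow>
        (0 ^ (N - i) *\<^sub>R (v ^ N * u 0, v ^ N * w 0)) \<bullet> e) (at_right 0)"
      by (intro tendsto_intros c)
    then have lim: "((\<lambda>t. (t ^ (N - i) *\<^sub>R (v ^ N * u (t *\<^sub>R v), v ^ N * w (t *\<^sub>R v))) \<bullet> e) \<longlongrightarrow> 0) (at_right 0)"
      using \<open>i < N\<close> by (simp add: power_0_left flip: zero_prod_def)
    have "(t ^ (N - i) *\<^sub>R (v ^ N * u (t *\<^sub>R v), v ^ N * w (t *\<^sub>R v))) \<bullet> e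
        = h (t *\<^sub>R v) \<bullet> e / t ^ i" if "t > 0" for t
    proof -
      have "h (t *\<^sub>R v) = t ^ N *\<^sub>R (v ^ N * u (t *\<^sub>R v), v ^ N * w (t *\<^sub>R v))"
        by (simp add: h power_mult_distrib scaleR_conv_of_real mult_ac)
      moreover have "t ^ N = t ^ (N - i) * t ^ i"
        using \<open>i < N\<close> by (simp flip: power_add)
      ultimately show ?thesis using that by (simp del: scaleR_Pair)
    qed
    then show "((\<lambda>t. h (t *\<^sub>R v) \<bullet> e / t ^ i) \<longlongrightarrow> 0) (at_right 0)"
      by (intro Lim_transform_eventually[OF lim] eventually_at_rightI[of 0 1]) auto
  qed
qed

lemma complex_root_exists:
  fixes z :: complex
  assumes "n > 0"
  shows "\<exists>w. w ^ n = z"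
proof (cases "z = 0")
  case False
  then have "exp (Ln z / of_nat n) ^ n = z"
    using assms by (simp flip: exp_of_nat_mult)
  then show ?thesis ..
qed (use assms in \<open>auto intro: exI[of _ 0]\<close>)

text \<open>The power \<open>v ^ n\<close> takes every complex value; the value \<open>cnj a\<close>
  turns the real part into the squared modulus of \<open>a\<close>.\<close>

lemma Re_mult_power_zero_imp_zero:
  fixes a :: complex
  assumes "n > 0" "\<And>v. Re (v ^ n * a) = 0"
  shows "a = 0"
proof -
  obtain v where "v ^ n = cnj a" using complex_root_exists[OF assms(1)] by blast
  then have "Re (cnj a * a) = 0" using assms(2)[of v] by simp
  then show ?thesis by (simp add: complex_eq_iff add_nonneg_eq_0_iff)
qed

lemma taylor_term_zero_vector:
  fixes f :: "'a::euclidean_space \<Rightarrow> real"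
  assumes "smooth_near 0 f" "m > 0"
  shows "taylor_term f m 0 = 0"
proof -
  obtain S where "smooth_on S f" "0 \<in> S"
    using assms(1) unfolding smooth_near_smooth_on by blast
  then have "(dir_deriv 0 ^^ m) f 0 = (diff_op (\<lambda>b. of_real (0 \<bullet> b)) ^^ m) f 0"
    by (rule dir_deriv_funpow_eq_diff_op)
  then show ?thesis
    using assms(2) by (cases m) (simp_all add: taylor_term_def diff_op_def)
qed

lemma smooth_near_isCont: "smooth_near x f \<Longrightarrow> isCont f x"
  unfolding smooth_near_smooth_on
  by (auto dest!: smooth_on_differentiable intro: differentiable_imp_continuous_within)

section \<open>The order of the defining function along a curve\<close>

lemma vanish_order_along_curve_le:
  fixes P :: "complex \<Rightarrow> real"
    and Q :: "complex \<times> real \<Rightarrow> real"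
    and \<rho> :: "complex \<times> complex \<Rightarrow> real"
  assumes P: "smooth_near 0 P" "P 0 = 0"
    and Q: "smooth_near (0, 0) Q" "Q (0, 0) = 0"
    and \<rho>: "\<And>z1 z2. \<rho> (z1, z2) = Re z1 + P z2 + Im z1 * Q (z2, Im z1)"
    and wirt: "\<And>N. (wirtinger ^^ N) (\<lambda>z. complex_of_real (P z)) 0 = 0"
    and m: "vanish_order P = enat m"
    and S: "open S" "0 \<in> S"
    and u: "u1 holomorphic_on S" "u2 holomorphic_on S" "(u1 0, u2 0) \<noteq> (0, 0)"
    and k: "k > 0"
    and h: "\<And>z. h z = (z ^ k * u1 z, z ^ k * u2 z)"
  shows "vanish_order (\<rho> \<circ> h) \<le> enat (m * k)"
proof (rule ccontr)
  assume "\<not> vanish_order (\<rho> \<circ> h) \<le> enat (m * k)"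
  then have "enat (Suc (m * k)) \<le> vanish_order (\<rho> \<circ> h)"
    by (cases "vanish_order (\<rho> \<circ> h)") auto
  then have van: "taylor_term (\<rho> \<circ> h) i v = 0" if "i \<le> m * k" for i v
    using that unfolding vanish_order_ge_iff by auto
  note P_low = vanish_order_eq_enat(2)[OF m]
  obtain v0 where v0: "taylor_term P m v0 \<noteq> 0" using vanish_order_eq_enat(1)[OF m] by blast
  then have "m > 0" using P(2) by (cases m) (auto simp: taylor_term_def)
  let ?T = "taylor_term P m"
  let ?h1 = "\<lambda>z. z ^ k * u1 z" and ?h2 = "\<lambda>z. z ^ k * u2 z"

  have hol: "?h1 holomorphic_on S" "?h2 holomorphic_on S"
    using u by (auto intro!: holomorphic_intros)
  note smooth_h = smooth_near_holomorphic[OF S hol(1)] smooth_near_holomorphic[OF S hol(2)]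
  have Im_h1: "smooth_near 0 (\<lambda>z. Im (?h1 z))"
    by (rule smooth_near_linear[OF bounded_linear_Im smooth_h(1)])
  have Q_h: "smooth_near 0 (\<lambda>z. Q (?h2 z, Im (?h1 z)))"
    by (rule smooth_near_compose[OF _ smooth_near_Pair[OF smooth_h(2) Im_h1]]) (use k Q in \<open>simp add: zero_power\<close>)
  have "smooth_near 0 (\<lambda>z. Re (?h1 z) + P (?h2 z) + Im (?h1 z) * Q (?h2 z, Im (?h1 z)))"
    by (intro smooth_near_add smooth_near_bilinear[OF bounded_bilinear_mult] Q_h Im_h1
        smooth_near_linear[OF bounded_linear_Re smooth_h(1)] smooth_near_compose[OF _ smooth_h(2)])
      (use k P in \<open>simp add: zero_power\<close>)
  then have smooth: "smooth_near 0 (\<rho> \<circ> h)"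
    by (simp add: o_def h \<rho>)

  have P_lim: "((\<lambda>t. P (?h2 (t *\<^sub>R v)) / t ^ (m * k)) \<longlongrightarrow> ?T (v ^ k * u2 0)) (at_right 0)" for v
  proof -
    \<comment> \<open>Along the ray, the second component has radius \<open>t ^ k\<close> and the
      moving direction \<open>v ^ k * u2 (t *\<^sub>R v)\<close>.\<close>
    have "((\<lambda>t. P (t ^ k *\<^sub>R (v ^ k * u2 (t *\<^sub>R v))) / (t ^ k) ^ m) \<longlongrightarrow> ?T (v ^ k * u2 0)) (at_right 0)"
      using k by (intro tendsto_taylor_term[OF P(1) P_low] tendsto_mult_left tendsto_along_ray[OF S u(2)])
        (auto intro!: tendsto_eq_intros)
    then show ?thesis
      by (simp add: power_mult_distrib scaleR_conv_of_real mult_ac flip: power_mult)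
  qed
  have Q_lim: "((\<lambda>t. Q (?h2 (t *\<^sub>R v), Im (?h1 (t *\<^sub>R v)))) \<longlongrightarrow> 0) (at_right 0)" for v
  proof -
    have "((\<lambda>t. (?h2 (t *\<^sub>R v), Im (?h1 (t *\<^sub>R v)))) \<longlongrightarrow> (?h2 0, Im (?h1 0))) (at_right 0)"
      by (intro tendsto_Pair tendsto_Im tendsto_along_ray[OF S hol(1)] tendsto_along_ray[OF S hol(2)])
    then show ?thesis
      using isCont_tendsto_compose[OF smooth_near_isCont[OF Q(1)]] Q(2) k by (simp add: zero_power)
  qed

  \<comment> \<open>This is the limit of \<open>(\<rho> \<circ> h) (t *\<^sub>R v) / t ^ j\<close>;
    the \<open>Q\<close> term drops out because \<open>Q\<close> tends to 0 while
    \<open>Im h1 / t ^ j\<close> stays bounded. As \<open>0 ^ 0 = 1\<close>, the contribution of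
    \<open>P\<close> survives exactly for \<open>j = m * k\<close>.\<close>
  have leading: "Re (v ^ j * u 0) + 0 ^ (m * k - j) * ?T (v ^ k * u2 0) = 0"
    if j: "j \<le> m * k" and hol_u: "u holomorphic_on S" and h1: "\<And>z. ?h1 z = z ^ j * u z" for j u v
  proof -
    have "((\<lambda>t. Re (v ^ j * u (t *\<^sub>R v)) + t ^ (m * k - j) * (P (?h2 (t *\<^sub>R v)) / t ^ (m * k))
          + Im (v ^ j * u (t *\<^sub>R v)) * Q (?h2 (t *\<^sub>R v), Im (?h1 (t *\<^sub>R v))))
        \<longlongrightarrow> Re (v ^ j * u 0) + 0 ^ (m * k - j) * ?T (v ^ k * u2 0) + Im (v ^ j * u 0) * 0) (at_right 0)"
      by (intro tendsto_add tendsto_mult tendsto_Re tendsto_Im tendsto_power tendsto_const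
          tendsto_ident_at P_lim Q_lim tendsto_along_ray[OF S hol_u])
    moreover have "Re (v ^ j * u (t *\<^sub>R v)) + t ^ (m * k - j) * (P (?h2 (t *\<^sub>R v)) / t ^ (m * k))
          + Im (v ^ j * u (t *\<^sub>R v)) * Q (?h2 (t *\<^sub>R v), Im (?h1 (t *\<^sub>R v)))
        = (\<rho> \<circ> h) (t *\<^sub>R v) / t ^ j" if "t > 0" for t
    proof -
      have "?h1 (t *\<^sub>R v) = t ^ j *\<^sub>R (v ^ j * u (t *\<^sub>R v))"
        by (simp only: h1) (simp add: power_mult_distrib scaleR_conv_of_real mult_ac)
      then have "Re (?h1 (t *\<^sub>R v)) = t ^ j * Re (v ^ j * u (t *\<^sub>R v))"
        "Im (?h1 (t *\<^sub>R v)) = t ^ j * Im (v ^ j * u (t *\<^sub>R v))"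
        by (simp_all only: scaleR_complex.sel)
      moreover have "t ^ (m * k) = t ^ (m * k - j) * t ^ j"
        using j by (simp flip: power_add)
      moreover have "(\<rho> \<circ> h) z = Re (?h1 z) + P (?h2 z) + Im (?h1 z) * Q (?h2 z, Im (?h1 z))" for z
        by (simp add: h \<rho>)
      ultimately show ?thesis
        using that by (simp add: add_divide_distrib del: times_complex.sel)
    qed
    ultimately have "((\<lambda>t. (\<rho> \<circ> h) (t *\<^sub>R v) / t ^ j)
        \<longlongrightarrow> Re (v ^ j * u 0) + 0 ^ (m * k - j) * ?T (v ^ k * u2 0) + Im (v ^ j * u 0) * 0) (at_right 0)"
      by (rule Lim_transform_eventually[OF _ eventually_at_rightI[of 0 1]]) auto
    moreover have "((\<lambda>t. (\<rho> \<circ> h) (t *\<^sub>R v) / t ^ j) \<longlongrightarrow> taylor_term (\<rho> \<circ> h) j v) (at_right 0)"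
      using van j by (intro tendsto_taylor_term[OF smooth]) (auto intro: tendsto_eq_intros)
    ultimately show ?thesis
      using tendsto_unique[OF trivial_limit_at_right_real] van[OF j] by fastforce
  qed

  \<comment> \<open>Otherwise \<open>?T\<close> is evaluated at 0, where it vanishes, and the
    relation for \<open>j = k\<close> forces \<open>u1 0 = 0\<close> too.\<close>
  have "u2 0 \<noteq> 0"
  proof
    assume "u2 0 = 0"
    then have "Re (v ^ k * u1 0) = 0" for v
      using leading[of k u1 v] u(1) \<open>m > 0\<close> taylor_term_zero_vector[OF P(1) \<open>m > 0\<close>] by simp
    then have "u1 0 = 0" by (rule Re_mult_power_zero_imp_zero[OF k])
    with u(3) \<open>u2 0 = 0\<close> show False by simp
  qed
  \<comment> \<open>The order of \<open>h1\<close> is compared with \<open>m * k\<close>: below it,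
    \<open>Re h1\<close> alone leads and cannot vanish in all directions; otherwise \<open>P\<close>
    has to be cancelled by \<open>Re h1\<close>.\<close>
  consider j w where "j < m * k" "w holomorphic_on S" "w 0 \<noteq> 0" "\<And>z. ?h1 z = z ^ j * w z"
    | w where "w holomorphic_on S" "\<And>z. ?h1 z = z ^ (m * k) * w z"
    using holomorphic_factor_power[OF S(1) hol(1), of "m * k"] by blast
  then show False
  proof cases
    case 1
    \<comment> \<open>For \<open>j = 0\<close> the value of \<open>h1\<close> at 0 would be
      \<open>w 0\<close>, which is nonzero, although \<open>k > 0\<close> makes it 0.\<close>
    have "j > 0" using 1(3) 1(4)[of 0] k by (cases j) (auto simp: zero_power)
    moreover have "Re (v ^ j * w 0) = 0" for v
      using leading[OF _ 1(2,4), of v] 1(1) by (simp add: zero_power)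
    ultimately show False using Re_mult_power_zero_imp_zero 1(3) by blast
  next
    case 2
    \<comment> \<open>Obtained by solving \<open>z = v ^ k * u2 0\<close> for \<open>v ^ k\<close>
      and inserting it into the relation for \<open>j = m * k\<close>. The case
      \<open>w 0 = 0\<close> is included.\<close>
    let ?a = "- w 0 / u2 0 ^ m"
    have T: "?T z = Re (?a * z ^ m)" for z
    proof -
      obtain v where v: "v ^ k = z / u2 0" using complex_root_exists[OF k] by blast
      have "v ^ (m * k) = (z / u2 0) ^ m" using v by (simp add: power_mult mult.commute)
      then have "?a * z ^ m = - (v ^ (m * k) * w 0)"
        by (simp add: power_divide)
      moreover have "v ^ k * u2 0 = z" using v \<open>u2 0 \<noteq> 0\<close> by simp
      ultimately show ?thesis
        using leading[OF order_refl 2, of v] by simp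
    qed
    have "?a = 0"
      using taylor_term_harmonic_imp_zero[OF P(1) \<open>m > 0\<close> wirt T] .
    then show False using T[of v0] v0 \<open>u2 0 \<noteq> 0\<close> by auto
  qed
qed

section \<open>The two implications between infinite type and infinite order of
  \<open>P\<close>\<close>

theorem theorem2:
  fixes P :: "complex \<Rightarrow> real"
    and Q :: "complex \<times> real \<Rightarrow> real"
    and \<rho> :: "complex \<times> complex \<Rightarrow> real"
  assumes "smooth_near 0 P"
    and "smooth_near (0, 0) Q"
    and "P 0 = 0"
    and "(P has_derivative (\<lambda>_. 0)) (at 0)"
    and "Q (0, 0) = 0"
    and "\<And>z1 z2. \<rho> (z1, z2) = Re z1 + P z2 + Im z1 * Q (z2, Im z1)"
    and "\<And>N::nat. (wirtinger ^^ N) (\<lambda>z. complex_of_real (P z)) 0 = 0"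
  shows "infinite_type_at_0 \<rho> \<longleftrightarrow> vanish_order P = \<infinity>"
proof
  assume "vanish_order P = \<infinity>"
  let ?h = "\<lambda>z::complex. (0::complex, z)"
  \<comment> \<open>Finiteness of the order of the curve: the component \<open>Re z2\<close> has
    nonzero first derivative in the direction 1.\<close>
  have "\<not> enat 2 \<le> vanish_order_map ?h"
  proof
    assume "enat 2 \<le> vanish_order_map ?h"
    moreover have "(0, 1) \<in> (Basis :: (complex \<times> complex) set)"
      by (simp add: Basis_prod_def Basis_complex_def)
    ultimately have "taylor_term (\<lambda>z. ?h z \<bullet> (0, 1)) 1 1 = 0"
      unfolding vanish_order_map_ge_iff vanish_order_ge_iff by force
    moreover have "dir_deriv 1 (\<lambda>z::complex. z \<bullet> 1) 0 = (1::complex) \<bullet> 1"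
      by (rule dir_deriv_eqI) (auto intro!: derivative_eq_intros)
    ultimately show False by (simp add: taylor_term_def)
  qed
  then obtain s where s: "vanish_order_map ?h = enat s" by (cases "vanish_order_map ?h") auto
  have "\<rho> \<circ> ?h = P" by (simp add: fun_eq_iff assms(6))
  \<comment> \<open>For \<open>s = 0\<close> the quotient is infinite as well, since
    \<open>inverse 0 = \<infinity>\<close> in \<open>ereal\<close>.\<close>
  then have "ereal_of_enat (vanish_order (\<rho> \<circ> ?h)) / ereal_of_enat (vanish_order_map ?h) = \<infinity>"
    using s \<open>vanish_order P = \<infinity>\<close> by (cases "s = 0") (auto simp: divide_ereal_def)
  then show "infinite_type_at_0 \<rho>"
    unfolding infinite_type_at_0_def using s
    by (intro allI impI exI[of _ ?h]) (auto intro: holomorphic_intros)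
next
  assume inf: "infinite_type_at_0 \<rho>"
  show "vanish_order P = \<infinity>"
  proof (rule ccontr)
    assume "vanish_order P \<noteq> \<infinity>"
    then obtain m where m: "vanish_order P = enat m" by auto
    \<comment> \<open>Positivity makes \<open>m\<close> itself an admissible bound \<open>l\<close>
      in the definition of infinite type.\<close>
    have "m > 0" using vanish_order_eq_enat(1)[OF m] assms(3) by (cases m) (auto simp: taylor_term_def)
    then obtain h where hol: "(\<lambda>z. fst (h z)) holomorphic_on ball 0 1" "(\<lambda>z. snd (h z)) holomorphic_on ball 0 1"
      and h0: "h 0 = (0, 0)" and fin: "vanish_order_map h \<noteq> \<infinity>"
      and gt: "ereal_of_enat (vanish_order (\<rho> \<circ> h)) / ereal_of_enat (vanish_order_map h) > ereal (real m)"
      using inf[unfolded infinite_type_at_0_def, rule_format, of "int m"] by auto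
    obtain s where s: "vanish_order_map h = enat s" using fin by auto
    \<comment> \<open>Factoring up to \<open>Suc s\<close> gives either \<open>k \<le> s\<close> or
      an order of \<open>h\<close> exceeding its actual value \<open>s\<close>.\<close>
    consider k u w where "k < Suc s" "u holomorphic_on ball 0 1" "w holomorphic_on ball 0 1"
        "(u 0, w 0) \<noteq> (0, 0)" "\<And>z. fst (h z) = z ^ k * u z" "\<And>z. snd (h z) = z ^ k * w z"
      | u w where "u holomorphic_on ball 0 1" "w holomorphic_on ball 0 1"
        "\<And>z. fst (h z) = z ^ Suc s * u z" "\<And>z. snd (h z) = z ^ Suc s * w z"
      using holomorphic_pair_factor_power[OF open_ball hol, of "Suc s"] by blast
    then show False
    proof cases
      case 1
      have h: "h z = (z ^ k * u z, z ^ k * w z)" for z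
        using 1(5,6) by (simp add: prod_eq_iff)
      have "k > 0" using h[of 0] h0 1(4) by (cases k) auto
      have "vanish_order (\<rho> \<circ> h) \<le> enat (m * k)"
        by (rule vanish_order_along_curve_le[OF assms(1,3,2,5,6,7) m open_ball _ 1(2,3,4) \<open>k > 0\<close> h]) auto
      then obtain n where n: "vanish_order (\<rho> \<circ> h) = enat n" "n \<le> m * k"
        by (cases "vanish_order (\<rho> \<circ> h)") auto
      \<comment> \<open>The chain \<open>n \<le> m * k \<le> m * s\<close> keeps the quotient at
        most \<open>m\<close>, against the choice of \<open>h\<close>.\<close>
      have "s > 0" "n \<le> m * s" using 1(1) \<open>k > 0\<close> n(2) mult_le_mono2[of k s m] by linarith+
      then have "real n / real s \<le> real m"
        by (simp add: divide_le_eq flip: of_nat_mult)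
      with gt show False using \<open>s > 0\<close> by (simp add: n s)
    next
      case 2
      have "enat (Suc s) \<le> vanish_order_map h"
        by (rule vanish_order_map_ge_of_factor[OF open_ball _ 2(1,2)]) (use 2(3,4) in \<open>auto simp: prod_eq_iff\<close>)
      then show False by (simp add: s)
    qed
  qed
qed

end
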